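(* Consider the Bayesian game defined by the payoff $u_{i,h}^\Gamma$ for $\Gamma\in\{S,U,W\}$. Let the information of consumer $i$ at slot $h$ be $I_{i,h}=\{g_{i,h},\sum_{j=1}^Ng_{j,h}\}$. Assume the preferences are $\sigma$-correlated at slot $h$, with $\sigma\in[0,1]$. Then the unique Bayesian Nash equilibrium strategy of consumer $i$ is linear in $\bar\omega_h$, $\sum_jg_{j,h}$ and $g_{i,h}$ for all $h$, namely $$s_{i,h}^\Gamma(I_{i,h})=a_h^\Gamma\Big(g_{i,h}-\frac1N\sum_{j=1}^Ng_{j,h}\Big)+b_h^\Gamma\Big(\frac1N\sum_{j=1}^Ng_{j,h}-\bar\omega_h\mu_h^\Gamma\Big),$$ where $a_h^\Gamma=\rho_h^\Gamma(1-\lambda_h^\Gamma\rho_h^\Gamma)^{-1}$, $b_h^\Gamma=\rho_h^\Gamma(1+\lambda_h^\Gamma\rho_h^\Gamma(N-1))^{-1}$ and $\rho_h^\Gamma=(2(\tau_h^\Gamma+\alpha_h))^{-1}$.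
   Context: There are $N$ consumers; in slot $h$ consumer $i$ consumes $l_{i,h}$, and $L_h=\sum_il_{i,h}$. Constants $\gamma_h,\alpha_h,\kappa_h>0$ are given. $\omega_h$ is a real random variable with mean $\bar\omega_h$, independent of $\mathbf{g}_h=(g_{1,h},\dots,g_{N,h})$. The preference vector $\mathbf{g}_h$ is normal with mean $\bar g_h\mathbf{1}$, $\bar g_h>0$; "$\sigma$-correlated" means that its covariance matrix has all diagonal entries $1$ and all off-diagonal entries $\sigma$. Payoffs: $u_{i,h}=-l_{i,h}\frac{\gamma_h}{N}(L_h+\omega_h)+g_{i,h}l_{i,h}-\alpha_h l_{i,h}^2$; $U_h=\sum_iu_{i,h}$; $W_h=U_h+\frac{\gamma_h}{N}(L_h+\omega_h)L_h-\frac{\kappa_h}{N}L_h^2$; $u_{i,h}^S=u_{i,h}$ (selfish), $u_{i,h}^U=U_h$ (altruistic), $u_{i,h}^W=W_h$ (welfare-maximizing). Constants: $\lambda_h^S=\mu_h^S=\tau_h^S=\gamma_h/N$; $\lambda_h^U=2\gamma_h/N$, $\mu_h^U=\tau_h^U=\gamma_h/N$; $\lambda_h^W=2\kappa_h/N$, $\mu_h^W=0$, $\tau_h^W=\kappa_h/N$. A strategy of consumer $i$ is a map $s_{i,h}$ from its possible information $I_{i,h}$ to $\mathbb{R}^+$. A Bayesian Nash equilibrium is a strategy profile $(s_{i,h}^\Gamma)_i$ such that for each $i$, all information $I_{i,h}$ and any strategy $s_{i,h}$ mapping $I_{i,h}$ to $\mathbb{R}^+$, $E[u_{i,h}^\Gamma(s_{i,h}^\Gamma,\mathbf{s}_{-i,h}^\Gamma)\mid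 I_{i,h}]\ge E[u_{i,h}^\Gamma(s_{i,h},\mathbf{s}_{-i,h}^\Gamma)\mid I_{i,h}]$.
   Formalization: Strategies and deviations take values in all of R instead of R^+ (the stated linear strategy is negative with positive probability, so it would not be admissible), and are Borel with finite second moment so that payoffs are integrable; uniqueness and "all information" are almost sure. *)

theory Defs
  imports "HOL-Probability.Probability"
begin

text \<open>
  One time slot with consumers \<open>{1..N}\<close>. Throughout, \<open>g j\<close> is the preference of consumer \<open>j\<close>,
  \<open>om\<close> the renewable term, and \<open>l j\<close> the consumption of consumer \<open>j\<close>.
\<close>

datatype behavior = Selfish | Altruistic | Welfare

definition total_load :: "nat \<Rightarrow> (nat \<Rightarrow> real) \<Rightarrow> real" where
  "total_load N l = (\<Sum>j\<in>{1..N}. l j)"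

definition own_payoff ::
    "nat \<Rightarrow> real \<Rightarrow> real \<Rightarrow> (nat \<Rightarrow> real) \<Rightarrow> real \<Rightarrow> (nat \<Rightarrow> real) \<Rightarrow> nat \<Rightarrow> real" where
  "own_payoff N \<gamma> \<alpha> g om l i =
     - l i * (\<gamma> / real N) * (total_load N l + om) + g i * l i - \<alpha> * (l i)\<^sup>2"

definition aggregate_payoff ::
    "nat \<Rightarrow> real \<Rightarrow> real \<Rightarrow> (nat \<Rightarrow> real) \<Rightarrow> real \<Rightarrow> (nat \<Rightarrow> real) \<Rightarrow> real" where
  "aggregate_payoff N \<gamma> \<alpha> g om l = (\<Sum>i\<in>{1..N}. own_payoff N \<gamma> \<alpha> g om l i)"

definition welfare ::
    "nat \<Rightarrow> real \<Rightarrow> real \<Rightarrow> real \<Rightarrow> (nat \<Rightarrow> real) \<Rightarrow> real \<Rightarrow> (nat \<Rightarrow> real) \<Rightarrow> real" where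
  "welfare N \<gamma> \<alpha> \<kappa> g om l =
     aggregate_payoff N \<gamma> \<alpha> g om l
     + \<gamma> / real N * (total_load N l + om) * total_load N l
     - \<kappa> / real N * (total_load N l)\<^sup>2"

fun payoff ::
    "behavior \<Rightarrow> nat \<Rightarrow> real \<Rightarrow> real \<Rightarrow> real \<Rightarrow> (nat \<Rightarrow> real) \<Rightarrow> real \<Rightarrow> (nat \<Rightarrow> real) \<Rightarrow> nat \<Rightarrow> real" where
  "payoff Selfish N \<gamma> \<alpha> \<kappa> g om l i = own_payoff N \<gamma> \<alpha> g om l i"
| "payoff Altruistic N \<gamma> \<alpha> \<kappa> g om l i = aggregate_payoff N \<gamma> \<alpha> g om l"
| "payoff Welfare N \<gamma> \<alpha> \<kappa> g om l i = welfare N \<gamma> \<alpha> \<kappa> g om l"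

text \<open>
  A normal law may be degenerate (a point mass). This is needed because fully correlated
  preferences have a singular covariance matrix.
\<close>

definition normal_rv :: "'w measure \<Rightarrow> ('w \<Rightarrow> real) \<Rightarrow> bool" where
  "normal_rv M X \<longleftrightarrow>
     (\<exists>m s. 0 < s \<and> distributed M lborel X (\<lambda>x. ennreal (normal_density m s x))) \<or>
     (X \<in> borel_measurable M \<and> (\<exists>m. AE w in M. X w = m))"

definition jointly_normal :: "'w measure \<Rightarrow> nat set \<Rightarrow> (nat \<Rightarrow> 'w \<Rightarrow> real) \<Rightarrow> bool" where
  "jointly_normal M I X \<longleftrightarrow> (\<forall>t. normal_rv M (\<lambda>w. \<Sum>i\<in>I. t i * X i w))"

definition normal_correlated_preferences ::
    "'w measure \<Rightarrow> nat \<Rightarrow> real \<Rightarrow> real \<Rightarrow> (nat \<Rightarrow> 'w \<Rightarrow> real) \<Rightarrow> bool" where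
  "normal_correlated_preferences M N gbar \<sigma> g \<longleftrightarrow>
     jointly_normal M {1..N} g \<and>
     (\<forall>i\<in>{1..N}. integral\<^sup>L M (g i) = gbar) \<and>
     (\<forall>i\<in>{1..N}. \<forall>j\<in>{1..N}.
        integral\<^sup>L M (\<lambda>w. (g i w - gbar) * (g j w - gbar)) = (if i = j then 1 else \<sigma>))"

text \<open>
  The library's \<open>indep_var\<close> requires both variables to have the same value type; here a real variable
  must be independent of a vector.
\<close>

definition independent_rvs ::
    "'w measure \<Rightarrow> 'a measure \<Rightarrow> ('w \<Rightarrow> 'a) \<Rightarrow> 'b measure \<Rightarrow> ('w \<Rightarrow> 'b) \<Rightarrow> bool" where
  "independent_rvs M A X B Y \<longleftrightarrow>
     X \<in> measurable M A \<and> Y \<in> measurable M B \<and>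
     prob_space.indep_set M
       (sets (vimage_algebra (space M) X A)) (sets (vimage_algebra (space M) Y B))"

text \<open>
  \<open>info i w\<close> is the information of consumer \<open>i\<close> in state \<open>w\<close>. A strategy is a measurable map from
  information to consumption whose realised consumption has a finite second moment; as payoffs are
  quadratic in consumption, this makes every conditional expectation below that of an integrable
  function (given square-integrable preferences and an integrable independent renewable term).
  Consumption is real-valued: the linear profile in normally distributed preferences is negative
  with positive probability, so it would not be admissible under a nonnegativity constraint.
\<close>

definition strategy :: "'w measure \<Rightarrow> ('w \<Rightarrow> 'x::topological_space) \<Rightarrow> ('x \<Rightarrow> real) \<Rightarrow> bool" where
  "strategy M I s \<longleftrightarrow> s \<in> borel_measurable borel \<and> integrable M (\<lambda>w. (s (I w))\<^sup>2)"

definition cond_exp_given ::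
    "'w measure \<Rightarrow> ('w \<Rightarrow> 'x::topological_space) \<Rightarrow> ('w \<Rightarrow> real) \<Rightarrow> 'w \<Rightarrow> real" where
  "cond_exp_given M I f = real_cond_exp M (vimage_algebra (space M) I borel) f"

definition played :: "(nat \<Rightarrow> 'w \<Rightarrow> 'x) \<Rightarrow> (nat \<Rightarrow> 'x \<Rightarrow> real) \<Rightarrow> 'w \<Rightarrow> nat \<Rightarrow> real" where
  "played info s w = (\<lambda>j. s j (info j w))"

text \<open>
  \<open>u l i w\<close> is the payoff of consumer \<open>i\<close> in state \<open>w\<close> under consumption \<open>l\<close>. Conditional
  expectations are determined up to null sets, so ``for all information'' means almost surely.
\<close>

definition bayesian_nash_equilibrium ::
    "'w measure \<Rightarrow> nat \<Rightarrow> (nat \<Rightarrow> 'w \<Rightarrow> 'x::topological_space) \<Rightarrow>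
     ((nat \<Rightarrow> real) \<Rightarrow> nat \<Rightarrow> 'w \<Rightarrow> real) \<Rightarrow> (nat \<Rightarrow> 'x \<Rightarrow> real) \<Rightarrow> bool" where
  "bayesian_nash_equilibrium M N info u s \<longleftrightarrow>
     (\<forall>i\<in>{1..N}. strategy M (info i) (s i)) \<and>
     (\<forall>i\<in>{1..N}. \<forall>t. strategy M (info i) t \<longrightarrow>
        (AE w in M.
           cond_exp_given M (info i) (\<lambda>w'. u (played info s w') i w') w
         \<ge> cond_exp_given M (info i) (\<lambda>w'. u (played info (s(i := t)) w') i w') w))"

definition agg_info :: "nat \<Rightarrow> (nat \<Rightarrow> 'w \<Rightarrow> real) \<Rightarrow> nat \<Rightarrow> 'w \<Rightarrow> real \<times> real" where
  "agg_info N g i w = (g i w, \<Sum>j\<in>{1..N}. g j w)"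

fun lambda_c :: "behavior \<Rightarrow> nat \<Rightarrow> real \<Rightarrow> real \<Rightarrow> real" where
  "lambda_c Selfish N \<gamma> \<kappa> = \<gamma> / real N"
| "lambda_c Altruistic N \<gamma> \<kappa> = 2 * \<gamma> / real N"
| "lambda_c Welfare N \<gamma> \<kappa> = 2 * \<kappa> / real N"

fun mu_c :: "behavior \<Rightarrow> nat \<Rightarrow> real \<Rightarrow> real" where
  "mu_c Selfish N \<gamma> = \<gamma> / real N"
| "mu_c Altruistic N \<gamma> = \<gamma> / real N"
| "mu_c Welfare N \<gamma> = 0"

fun tau_c :: "behavior \<Rightarrow> nat \<Rightarrow> real \<Rightarrow> real \<Rightarrow> real" where
  "tau_c Selfish N \<gamma> \<kappa> = \<gamma> / real N"
| "tau_c Altruistic N \<gamma> \<kappa> = \<gamma> / real N"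
| "tau_c Welfare N \<gamma> \<kappa> = \<kappa> / real N"

definition rho_c :: "behavior \<Rightarrow> nat \<Rightarrow> real \<Rightarrow> real \<Rightarrow> real \<Rightarrow> real" where
  "rho_c \<Gamma> N \<gamma> \<alpha> \<kappa> = inverse (2 * (tau_c \<Gamma> N \<gamma> \<kappa> + \<alpha>))"

definition a_c :: "behavior \<Rightarrow> nat \<Rightarrow> real \<Rightarrow> real \<Rightarrow> real \<Rightarrow> real" where
  "a_c \<Gamma> N \<gamma> \<alpha> \<kappa> =
     rho_c \<Gamma> N \<gamma> \<alpha> \<kappa> * inverse (1 - lambda_c \<Gamma> N \<gamma> \<kappa> * rho_c \<Gamma> N \<gamma> \<alpha> \<kappa>)"

definition b_c :: "behavior \<Rightarrow> nat \<Rightarrow> real \<Rightarrow> real \<Rightarrow> real \<Rightarrow> real" where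
  "b_c \<Gamma> N \<gamma> \<alpha> \<kappa> =
     rho_c \<Gamma> N \<gamma> \<alpha> \<kappa> *
     inverse (1 + lambda_c \<Gamma> N \<gamma> \<kappa> * rho_c \<Gamma> N \<gamma> \<alpha> \<kappa> * (real N - 1))"

text \<open>The argument is the information pair: own preference and sum of all preferences.\<close>

definition linear_strategy ::
    "behavior \<Rightarrow> nat \<Rightarrow> real \<Rightarrow> real \<Rightarrow> real \<Rightarrow> real \<Rightarrow> real \<times> real \<Rightarrow> real" where
  "linear_strategy \<Gamma> N \<gamma> \<alpha> \<kappa> ombar = (\<lambda>(gi, G).
     a_c \<Gamma> N \<gamma> \<alpha> \<kappa> * (gi - 1 / real N * G)
     + b_c \<Gamma> N \<gamma> \<alpha> \<kappa> * (1 / real N * G - ombar * mu_c \<Gamma> N \<gamma>))"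

end

theory Submission
  imports Defs
begin

text \<open>
  In the own consumption \<open>x\<close> every payoff is a concave quadratic
  \<open>c + x * (g\<^sub>i - \<mu> * \<omega> - \<lambda> * R) - (\<tau> + \<alpha>) * x\<^sup>2\<close>, where \<open>R\<close> is the load of the others. As \<open>\<omega>\<close> is
  independent of the information, the equilibria are the solutions of
  \<open>s\<^sub>i = \<rho> * (g\<^sub>i - \<mu> * E[\<omega>] - \<lambda> * E[R | I\<^sub>i])\<close>. For the linear profile \<open>R\<close> is a function of \<open>g\<^sub>i\<close> and
  \<open>\<Sum>g\<^sub>j\<close>, so that \<open>E[R | I\<^sub>i] = R\<close> and the equation is an algebraic identity. The difference \<open>d\<close>
  of two solutions satisfies \<open>d\<^sub>i = - \<lambda> * \<rho> * E[\<Sum>j\<noteq>i. d\<^sub>j | I\<^sub>i]\<close>; multiplying by \<open>d\<^sub>i\<close>, integrating and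
  summing over \<open>i\<close> gives \<open>(1 - \<lambda> * \<rho>) * (\<Sum>i. E[d\<^sub>i\<^sup>2]) + \<lambda> * \<rho> * E[(\<Sum>i. d\<^sub>i)\<^sup>2] = 0\<close> with \<open>0 < \<lambda> * \<rho> < 1\<close>,
  hence \<open>d = 0\<close>.
\<close>

section \<open>Square-integrable functions\<close>

lemma integrable_mult_square_integrable:
  fixes f g :: "'a \<Rightarrow> real"
  assumes [measurable]: "f \<in> borel_measurable M" "g \<in> borel_measurable M"
    and "integrable M (\<lambda>x. (f x)\<^sup>2)" "integrable M (\<lambda>x. (g x)\<^sup>2)"
  shows "integrable M (\<lambda>x. f x * g x)"
proof (rule Bochner_Integration.integrable_bound)
  show "integrable M (\<lambda>x. (f x)\<^sup>2 + (g x)\<^sup>2)" using assms by simp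
  have "\<bar>a * b\<bar> \<le> a\<^sup>2 + b\<^sup>2" for a b :: real
  proof -
    have "2 * \<bar>a\<bar> * \<bar>b\<bar> \<le> a\<^sup>2 + b\<^sup>2" using sum_squares_bound[of "\<bar>a\<bar>" "\<bar>b\<bar>"] by simp
    moreover have "0 \<le> \<bar>a\<bar> * \<bar>b\<bar>" by simp
    ultimately show ?thesis unfolding abs_mult by linarith
  qed
  then show "AE x in M. norm (f x * g x) \<le> norm ((f x)\<^sup>2 + (g x)\<^sup>2)" by simp
qed measurable

lemma integrable_square_diff:
  fixes f g :: "'a \<Rightarrow> real"
  assumes "f \<in> borel_measurable M" "g \<in> borel_measurable M"
    and "integrable M (\<lambda>x. (f x)\<^sup>2)" "integrable M (\<lambda>x. (g x)\<^sup>2)"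
  shows "integrable M (\<lambda>x. (f x - g x)\<^sup>2)"
  unfolding power2_diff mult.assoc
  using integrable_mult_square_integrable[OF assms] assms(3,4) by simp

lemma integrable_square_sum:
  fixes f :: "'i \<Rightarrow> 'a \<Rightarrow> real"
  assumes "\<And>i. i \<in> J \<Longrightarrow> f i \<in> borel_measurable M" "\<And>i. i \<in> J \<Longrightarrow> integrable M (\<lambda>x. (f i x)\<^sup>2)"
  shows "integrable M (\<lambda>x. (\<Sum>i\<in>J. f i x)\<^sup>2)"
  unfolding power2_eq_square sum_product
  by (intro Bochner_Integration.integrable_sum integrable_mult_square_integrable assms)

section \<open>Independence and conditional expectation\<close>

lemma sets_vimage_algebra_subset:
  assumes "f \<in> measurable K A"
  shows "sets (vimage_algebra (space K) f A) \<subseteq> sets K"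
  unfolding sets_vimage_algebra
  by (rule sets.sigma_sets_subset) (use measurable_sets[OF assms] in auto)

text \<open>The sigma-algebra generated by \<open>Z\<close> lies inside the one generated by
  \<open>Y\<close>, and independence passes to smaller families. The gain is
  \<open>indep_var\<close>, for which integrals of products factor.\<close>

lemma independent_rvs_imp_indep_var:
  assumes M: "prob_space M" and ind: "independent_rvs M A X B Y"
    and Z: "Z \<in> measurable (vimage_algebra (space M) Y B) C"
  shows "prob_space.indep_var M A X C Z"
proof -
  interpret prob_space M by (fact M)
  let ?V = "vimage_algebra (space M) Y B"
  have X: "X \<in> measurable M A" and Y: "Y \<in> measurable M B"
    and indep: "indep_set (sets (vimage_algebra (space M) X A)) (sets ?V)"
    using ind by (auto simp: independent_rvs_def)
  have V: "sets ?V \<subseteq> sets M" using indep by (rule indep_setD_ev2)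
  have "Z \<in> measurable M C"
    using Z V by (auto simp: measurable_def)
  moreover have "indep_set (sets (vimage_algebra (space M) X A)) (sets (vimage_algebra (space M) Z C))"
    using indep sets_vimage_algebra_subset[OF Z] unfolding indep_set_def
    by (elim indep_sets_mono_sets) (simp split: bool.split)
  ultimately show ?thesis
    unfolding indep_var_eq using X by (simp add: sets_vimage_algebra)
qed

text \<open>For \<open>A\<close> in \<open>F\<close> the indicator is measurable for the
  sigma-algebra generated by \<open>Y\<close>, so the integral of \<open>X\<close> over
  \<open>A\<close> is the mean of \<open>X\<close> times the probability of \<open>A\<close>. The
  constant mean thus has the integrals over \<open>F\<close> that characterise the conditional
  expectation.\<close>

lemma real_cond_exp_independent:
  assumes M: "prob_space M" and ind: "independent_rvs M borel X B Y"
    and X: "integrable M X" and F: "sets F \<subseteq> sets (vimage_algebra (space M) Y B)"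
    and sub: "subalgebra M F"
  shows "AE w in M. real_cond_exp M F X w = integral\<^sup>L M X"
proof -
  interpret prob_space M by (fact M)
  interpret finite_measure_subalgebra M F
    by unfold_locales (fact sub)
  show ?thesis
  proof (rule real_cond_exp_charact)
    fix A assume A: "A \<in> sets F"
    then have AM: "A \<in> sets M" using sub by (auto simp: subalgebra_def)
    have "indicator A \<in> borel_measurable (vimage_algebra (space M) Y B)"
      using A F by auto
    then have iv: "indep_var borel X borel (indicator A :: _ \<Rightarrow> real)"
      by (rule independent_rvs_imp_indep_var[OF M ind])
    have "integrable M (indicator A :: _ \<Rightarrow> real)"
      by (rule integrable_const_bound[where B = 1]) (use AM in auto)
    from indep_var_lebesgue_integral[OF iv X this]
    show "(\<integral>w\<in>A. X w \<partial>M) = (\<integral>w\<in>A. expectation X \<partial>M)"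
      using AM by (simp add: set_lebesgue_integral_def mult.commute)
  qed (use X in auto)
qed

section \<open>The payoff as a quadratic in own consumption\<close>

text \<open>Source of the constants: the product of own and other consumption arises once in the
  selfish payoff but twice in the aggregate one, hence the factor 2 in \<open>lambda_c\<close>. In
  the welfare the terms with \<gamma> cancel, and \<open>om\<close> with them, so that
  \<open>mu_c\<close> is zero and the squared total load is weighted by \<kappa>.\<close>

lemma payoff_quadratic:
  assumes i: "i \<in> {1..N}"
  shows "payoff \<Gamma> N \<gamma> \<alpha> \<kappa> g om (l(i := x)) i =
    payoff \<Gamma> N \<gamma> \<alpha> \<kappa> g om (l(i := 0)) i
    + x * (g i - mu_c \<Gamma> N \<gamma> * om - lambda_c \<Gamma> N \<gamma> \<kappa> * (\<Sum>j\<in>{1..N}-{i}. l j))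
    - (tau_c \<Gamma> N \<gamma> \<kappa> + \<alpha>) * x\<^sup>2"
proof -
  let ?R = "\<Sum>j\<in>{1..N}-{i}. l j"
  have L: "total_load N (l(i := y)) = y + ?R" for y
    unfolding total_load_def using i by (simp add: sum.remove[of _ i])
  let ?P = "\<lambda>y. \<Sum>j\<in>{1..N}-{i}. g j * l j - \<alpha> * (l j)\<^sup>2"
  have own: "own_payoff N \<gamma> \<alpha> g om m j = g j * m j - \<alpha> * (m j)\<^sup>2 - \<gamma> / real N * (total_load N m + om) * m j"
    for m j by (simp add: own_payoff_def)
  \<comment> \<open>The price factor is common to all consumers, so their price terms add up to a
    single product with the total load.\<close>
  have agg: "aggregate_payoff N \<gamma> \<alpha> g om (l(i := y)) =
     g i * y - \<alpha> * y\<^sup>2 + (\<Sum>j\<in>{1..N}-{i}. g j * l j - \<alpha> * (l j)\<^sup>2)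
     - \<gamma> / real N * (y + ?R + om) * (y + ?R)" for y
  proof -
    have "aggregate_payoff N \<gamma> \<alpha> g om (l(i := y)) =
      (\<Sum>j\<in>{1..N}. g j * (l(i := y)) j - \<alpha> * ((l(i := y)) j)\<^sup>2)
      - \<gamma> / real N * (y + ?R + om) * total_load N (l(i := y))"
      by (simp only: aggregate_payoff_def own L sum_subtractf sum_distrib_left[symmetric]
          L[unfolded total_load_def])
    also have "(\<Sum>j\<in>{1..N}. g j * (l(i := y)) j - \<alpha> * ((l(i := y)) j)\<^sup>2)
      = g i * y - \<alpha> * y\<^sup>2 + (\<Sum>j\<in>{1..N}-{i}. g j * l j - \<alpha> * (l j)\<^sup>2)"
      using i by (simp add: sum.remove[of _ i])
    finally show ?thesis by (simp only: L)
  qed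
  have N: "real N \<noteq> 0" using i by auto
  show ?thesis
    by (cases \<Gamma>; simp add: own agg welfare_def L; use N in \<open>simp add: field_simps power2_eq_square\<close>)
qed

section \<open>The game of a single slot: measurability and integrability\<close>

locale consumption_game = prob_space M for M :: "'w measure" +
  fixes \<Gamma> :: behavior and N :: nat and \<gamma> \<alpha> \<kappa> ombar :: real
    and g :: "nat \<Rightarrow> 'w \<Rightarrow> real" and om :: "'w \<Rightarrow> real"
  assumes N_pos: "N \<ge> 1" and pos: "\<gamma> > 0" "\<alpha> > 0" "\<kappa> > 0"
    and om_integrable: "integrable M om" and om_mean: "expectation om = ombar"
    and indep: "independent_rvs M borel om (Pi\<^sub>M {1..N} (\<lambda>_. borel)) (\<lambda>w. \<lambda>i\<in>{1..N}. g i w)"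
    and g_square: "\<And>i. i \<in> {1..N} \<Longrightarrow> integrable M (\<lambda>w. (g i w)\<^sup>2)"
begin

abbreviation "info \<equiv> agg_info N g"
abbreviation "lam \<equiv> lambda_c \<Gamma> N \<gamma> \<kappa>"
abbreviation "mu \<equiv> mu_c \<Gamma> N \<gamma>"
abbreviation "rho \<equiv> rho_c \<Gamma> N \<gamma> \<alpha> \<kappa>"
abbreviation "curv \<equiv> tau_c \<Gamma> N \<gamma> \<kappa> + \<alpha>"
abbreviation "u \<equiv> \<lambda>l i w. payoff \<Gamma> N \<gamma> \<alpha> \<kappa> (\<lambda>j. g j w) (om w) l i"
text \<open>Measurability is tracked for \<open>V\<close>, the sigma-algebra of the preference
  vector, because \<open>om\<close> is independent of everything measurable for it. The information
  sigma-algebras \<open>F i\<close> are contained in it.\<close>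

abbreviation "V \<equiv> vimage_algebra (space M) (\<lambda>w. \<lambda>i\<in>{1..N}. g i w) (Pi\<^sub>M {1..N} (\<lambda>_. borel))"
abbreviation "F \<equiv> \<lambda>i. vimage_algebra (space M) (info i) borel"

definition others :: "(nat \<Rightarrow> real \<times> real \<Rightarrow> real) \<Rightarrow> nat \<Rightarrow> 'w \<Rightarrow> real" where
  "others s i w = (\<Sum>j\<in>{1..N}-{i}. s j (info j w))"

text \<open>The vertex of the conditionally expected quadratic. It depends on the state and not on
  the information pair, since a conditional expectation is given as a function of the state.\<close>

definition best_response :: "(nat \<Rightarrow> real \<times> real \<Rightarrow> real) \<Rightarrow> nat \<Rightarrow> 'w \<Rightarrow> real" where
  "best_response s i w = rho * (g i w - mu * ombar - lam * cond_exp_given M (info i) (others s i) w)"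

lemma curv_pos: "curv > 0"
  using N_pos pos by (cases \<Gamma>) (auto intro!: add_nonneg_pos)

text \<open>In all three cases \<open>lam\<close> is at most twice \<open>tau_c\<close>, hence below
  \<open>2 * curv\<close> as \<alpha> is positive, and \<open>rho\<close> is the reciprocal of
  \<open>2 * curv\<close>. The bounds keep the denominators of \<open>a_c\<close> and
  \<open>b_c\<close> positive and drive the uniqueness proof.\<close>

lemma lam_rho: "0 < lam * rho" "lam * rho < 1"
proof -
  show "0 < lam * rho"
    using N_pos pos curv_pos by (cases \<Gamma>) (auto simp: rho_c_def)
  have "lam \<le> 2 * tau_c \<Gamma> N \<gamma> \<kappa>" using N_pos pos by (cases \<Gamma>) (auto simp: field_simps)
  then have "lam < 2 * curv" using pos by simp
  then show "lam * rho < 1" using curv_pos by (simp add: rho_c_def field_simps)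
qed

lemma borel_measurable_V_imp: "f \<in> measurable V A \<Longrightarrow> f \<in> measurable M A"
proof -
  have "sets V \<subseteq> sets M" using indep unfolding independent_rvs_def by (auto dest: indep_setD_ev2)
  then show "f \<in> measurable V A \<Longrightarrow> f \<in> measurable M A" by (auto simp: measurable_def)
qed

lemma measurable_g_V [measurable]: "i \<in> {1..N} \<Longrightarrow> g i \<in> borel_measurable V"
proof -
  assume i: "i \<in> {1..N}"
  have "(\<lambda>w. \<lambda>i\<in>{1..N}. g i w) \<in> measurable V (Pi\<^sub>M {1..N} (\<lambda>_. borel))"
    by (rule measurable_vimage_algebra1) (auto simp: space_PiM)
  from measurable_compose[OF this measurable_component_singleton[OF i]]
  show ?thesis using i by simp
qed

lemma measurable_info_V: "i \<in> {1..N} \<Longrightarrow> info i \<in> measurable V borel"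
  unfolding agg_info_def borel_prod[symmetric] by measurable

lemma sets_F_subset: "i \<in> {1..N} \<Longrightarrow> sets (F i) \<subseteq> sets V"
  using sets_vimage_algebra_subset[OF measurable_info_V] by simp

lemma subalgebra_F: "i \<in> {1..N} \<Longrightarrow> subalgebra M (F i)"
  using sets_vimage_algebra_subset[OF borel_measurable_V_imp[OF measurable_info_V]]
  by (simp add: subalgebra_def)

lemma measurable_info_F: "info i \<in> measurable (F i) borel"
  by (rule measurable_vimage_algebra1) auto

lemma measurable_info_F_compose:
  assumes "s \<in> borel_measurable borel"
  shows "(\<lambda>w. s (info i w)) \<in> borel_measurable (F i)"
  using measurable_compose[OF measurable_info_F assms] .

lemma strategy_V:
  assumes "i \<in> {1..N}" "strategy M (info i) s"
  shows "(\<lambda>w. s (info i w)) \<in> borel_measurable V"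
  using measurable_compose[OF measurable_info_V[OF assms(1)]] assms(2) by (auto simp: strategy_def)

lemmas strategy_M = borel_measurable_V_imp[OF strategy_V]

lemma strategy_square: "strategy M I s \<Longrightarrow> integrable M (\<lambda>w. (s (I w))\<^sup>2)"
  by (simp add: strategy_def)

text \<open>No second moment of \<open>om\<close> is assumed, so the product is controlled by
  independence instead of by squares.\<close>

lemma integrable_mult_om:
  assumes "f \<in> borel_measurable V" "integrable M (\<lambda>w. (f w)\<^sup>2)"
  shows "integrable M (\<lambda>w. f w * om w)"
proof -
  have "integrable M f"
    using square_integrable_imp_integrable[OF borel_measurable_V_imp[OF assms(1)] assms(2)] .
  from indep_var_integrable[OF independent_rvs_imp_indep_var[OF prob_space_axioms indep assms(1)]
      om_integrable this]
  show ?thesis by (simp add: mult.commute)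
qed

text \<open>Each term is, up to a constant, a product of two square-integrable functions or of a
  \<open>V\<close>-measurable one with \<open>om\<close>.\<close>

lemma integrable_payoff:
  assumes l: "\<And>j. j \<in> {1..N} \<Longrightarrow> l j \<in> borel_measurable V"
    "\<And>j. j \<in> {1..N} \<Longrightarrow> integrable M (\<lambda>w. (l j w)\<^sup>2)"
    and i: "i \<in> {1..N}"
  shows "integrable M (\<lambda>w. u (\<lambda>j. l j w) i w)"
proof -
  let ?L = "\<lambda>w. \<Sum>j\<in>{1..N}. l j w"
  have lM: "l j \<in> borel_measurable M" if "j \<in> {1..N}" for j
    using borel_measurable_V_imp[OF l(1)[OF that]] .
  have gM: "g j \<in> borel_measurable M" if "j \<in> {1..N}" for j
    using borel_measurable_V_imp[OF measurable_g_V[OF that]] .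
  have LM: "?L \<in> borel_measurable M" using lM by measurable
  have L2: "integrable M (\<lambda>w. (?L w)\<^sup>2)" by (rule integrable_square_sum) (use lM l in auto)
  have own: "integrable M (\<lambda>w. own_payoff N \<gamma> \<alpha> (\<lambda>j. g j w) (om w) (\<lambda>j. l j w) j)"
    if j: "j \<in> {1..N}" for j
  proof -
    have "integrable M (\<lambda>w. g j w * l j w - \<alpha> * (l j w)\<^sup>2
      - (\<gamma> / real N) * (l j w * ?L w) - (\<gamma> / real N) * (l j w * om w))"
      by (intro Bochner_Integration.integrable_diff integrable_mult_right
          integrable_mult_square_integrable integrable_mult_om l gM lM LM L2 j g_square)
    then show ?thesis
      by (rule back_subst[of "integrable M"]) (auto simp: own_payoff_def total_load_def algebra_simps)
  qed
  have agg: "integrable M (\<lambda>w. aggregate_payoff N \<gamma> \<alpha> (\<lambda>j. g j w) (om w) (\<lambda>j. l j w))"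
    unfolding aggregate_payoff_def by (intro Bochner_Integration.integrable_sum own)
  have "?L \<in> borel_measurable V" using l(1) by measurable
  then have Lom: "integrable M (\<lambda>w. ?L w * om w)" using L2 by (rule integrable_mult_om)
  have "integrable M (\<lambda>w. aggregate_payoff N \<gamma> \<alpha> (\<lambda>j. g j w) (om w) (\<lambda>j. l j w)
      + (\<gamma> / real N) * (?L w)\<^sup>2 + (\<gamma> / real N) * (?L w * om w) - (\<kappa> / real N) * (?L w)\<^sup>2)"
    by (intro Bochner_Integration.integrable_diff Bochner_Integration.integrable_add
        integrable_mult_right agg L2 Lom)
  then have "integrable M (\<lambda>w. welfare N \<gamma> \<alpha> \<kappa> (\<lambda>j. g j w) (om w) (\<lambda>j. l j w))"
    by (rule back_subst[of "integrable M"])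
      (auto simp: welfare_def total_load_def algebra_simps power2_eq_square)
  then show ?thesis using own[OF i] agg by (cases \<Gamma>) auto
qed

lemma measurable_others_V:
  assumes "\<And>j. j \<in> {1..N} \<Longrightarrow> strategy M (info j) (s j)"
  shows "others s i \<in> borel_measurable V"
  unfolding others_def using strategy_V[OF _ assms] by (intro borel_measurable_sum) auto

lemma square_integrable_others:
  assumes "\<And>j. j \<in> {1..N} \<Longrightarrow> strategy M (info j) (s j)"
  shows "integrable M (\<lambda>w. (others s i w)\<^sup>2)"
  unfolding others_def
  by (rule integrable_square_sum) (use strategy_M[OF _ assms] strategy_square[OF assms] in auto)

lemma played_upd: "played info (s(i := t)) w = (played info s w)(i := t (info i w))"
  by (auto simp: played_def)

section \<open>Equilibria as mutual best responses\<close>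

text \<open>Own consumption is known given the information and can be pulled out, \<open>om\<close>
  is replaced by its mean, and completing the square around \<open>best_response\<close> gives the
  difference.\<close>

lemma cond_exp_payoff_diff:
  assumes s: "\<And>j. j \<in> {1..N} \<Longrightarrow> strategy M (info j) (s j)"
    and i: "i \<in> {1..N}" and t: "strategy M (info i) t"
  shows "AE w in M.
    cond_exp_given M (info i) (\<lambda>w'. u (played info s w') i w') w
    - cond_exp_given M (info i) (\<lambda>w'. u (played info (s(i := t)) w') i w') w
    = curv * ((t (info i w) - best_response s i w)\<^sup>2 - (s i (info i w) - best_response s i w)\<^sup>2)"
proof -
  interpret finite_measure_subalgebra M "F i"
    by unfold_locales (fact subalgebra_F[OF i])
  let ?x = "\<lambda>w. s i (info i w)" and ?y = "\<lambda>w. t (info i w)"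
  let ?R = "others s i"
  let ?E = "real_cond_exp M (F i)"
  let ?Z = "\<lambda>w. g i w - mu * om w - lam * ?R w"
  let ?us = "\<lambda>w. u (played info s w) i w" and ?ut = "\<lambda>w. u (played info (s(i := t)) w) i w"
  have st: "\<And>j. j \<in> {1..N} \<Longrightarrow> strategy M (info j) ((s(i := t)) j)" using s t by auto
  have us: "integrable M ?us" and ut: "integrable M ?ut"
    unfolding played_def
    by (rule integrable_payoff[OF strategy_V[OF _ s] strategy_square[OF s] i];simp)
      (rule integrable_payoff[OF strategy_V[OF _ st] strategy_square[OF st] i];simp)
  have xF: "?x \<in> borel_measurable (F i)" and yF: "?y \<in> borel_measurable (F i)"
    using s[OF i] t by (auto intro!: measurable_info_F_compose simp: strategy_def)
  have xM: "?x \<in> borel_measurable M" and yM: "?y \<in> borel_measurable M"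
    and xV: "?x \<in> borel_measurable V" and yV: "?y \<in> borel_measurable V"
    using i s[OF i] t strategy_M strategy_V by auto
  have x2: "integrable M (\<lambda>w. (?x w)\<^sup>2)" and y2: "integrable M (\<lambda>w. (?y w)\<^sup>2)"
    using s[OF i] t strategy_square by auto
  have gM: "g i \<in> borel_measurable M" by (rule borel_measurable_V_imp[OF measurable_g_V[OF i]])
  have gi: "integrable M (g i)" by (rule square_integrable_imp_integrable[OF gM g_square[OF i]])
  \<comment> \<open>Own preference is the first component of the information, so conditioning leaves
    it unchanged.\<close>
  have "(\<lambda>w. fst (info i w)) \<in> borel_measurable (F i)"
    by (rule measurable_info_F_compose) (intro borel_measurable_continuous_onI continuous_intros)
  then have gF: "g i \<in> borel_measurable (F i)" by (simp add: agg_info_def)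
  have RM: "?R \<in> borel_measurable M" by (rule borel_measurable_V_imp[OF measurable_others_V[OF s]])
  have R2: "integrable M (\<lambda>w. (?R w)\<^sup>2)" by (rule square_integrable_others[OF s])
  have Ri: "integrable M ?R" by (rule square_integrable_imp_integrable[OF RM R2])
  have d2: "integrable M (\<lambda>w. (?x w - ?y w)\<^sup>2)" by (rule integrable_square_diff[OF xM yM x2 y2])
  have dV: "(\<lambda>w. ?x w - ?y w) \<in> borel_measurable V" using xV yV by measurable
  have dM: "(\<lambda>w. ?x w - ?y w) \<in> borel_measurable M" using xM yM by measurable
  have "integrable M (\<lambda>w. (?x w - ?y w) * g i w - mu * ((?x w - ?y w) * om w)
     - lam * ((?x w - ?y w) * ?R w))"
    by (intro Bochner_Integration.integrable_diff integrable_mult_right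
          integrable_mult_square_integrable integrable_mult_om dV dM d2 gM RM R2 g_square[OF i])
  then have dZ: "integrable M (\<lambda>w. (?x w - ?y w) * ?Z w)"
    by (rule back_subst[of "integrable M"]) (auto simp: algebra_simps)
  have q: "integrable M (\<lambda>w. curv * ((?x w)\<^sup>2 - (?y w)\<^sup>2))"
    using x2 y2 by simp
  have Zi: "integrable M ?Z" using gi om_integrable Ri by simp
  \<comment> \<open>The two profiles differ at \<open>i\<close> alone, so the intercept at own
    consumption 0 cancels.\<close>
  have diff: "?us w - ?ut w = (?x w - ?y w) * ?Z w - curv * ((?x w)\<^sup>2 - (?y w)\<^sup>2)" for w
  proof -
    let ?l = "played info s w"
    have "?l(i := ?x w) = ?l" by (auto simp: played_def)
    then have "?us w = u (?l(i := ?x w)) i w" by (simp only:)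
    moreover have "?ut w = u (?l(i := ?y w)) i w" by (simp only: played_upd)
    moreover have "(\<Sum>j\<in>{1..N}-{i}. ?l j) = ?R w" by (simp add: played_def others_def)
    ultimately show ?thesis
      by (simp only: payoff_quadratic[OF i, of _ _ _ _ _ _ ?l "?x w"]
          payoff_quadratic[OF i, of _ _ _ _ _ _ ?l "?y w"]) (simp add: algebra_simps)
  qed
  have "AE w in M. ?E (\<lambda>w. ?us w - ?ut w) w = ?E ?us w - ?E ?ut w"
    by (rule real_cond_exp_diff[OF us ut])
  moreover have "AE w in M. ?E (\<lambda>w. (?x w - ?y w) * ?Z w - curv * ((?x w)\<^sup>2 - (?y w)\<^sup>2)) w
     = ?E (\<lambda>w. (?x w - ?y w) * ?Z w) w - ?E (\<lambda>w. curv * ((?x w)\<^sup>2 - (?y w)\<^sup>2)) w"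
    by (rule real_cond_exp_diff[OF dZ q])
  moreover have "AE w in M. ?E (\<lambda>w. (?x w - ?y w) * ?Z w) w = (?x w - ?y w) * ?E ?Z w"
    by (rule real_cond_exp_mult) (use xF yF Zi dZ in auto)
  moreover have "AE w in M. ?E (\<lambda>w. curv * ((?x w)\<^sup>2 - (?y w)\<^sup>2)) w = curv * ((?x w)\<^sup>2 - (?y w)\<^sup>2)"
    by (rule real_cond_exp_F_meas[OF q]) (use xF yF in measurable)
  moreover have "AE w in M. ?E ?Z w = ?E (\<lambda>w. g i w - mu * om w) w - ?E (\<lambda>w. lam * ?R w) w"
    by (rule real_cond_exp_diff) (use gi om_integrable Ri in auto)
  moreover have "AE w in M. ?E (\<lambda>w. g i w - mu * om w) w = ?E (g i) w - ?E (\<lambda>w. mu * om w) w"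
    by (rule real_cond_exp_diff) (use gi om_integrable in auto)
  moreover have "AE w in M. ?E (\<lambda>w. lam * ?R w) w = lam * ?E ?R w"
    by (rule real_cond_exp_cmult[OF Ri])
  moreover have "AE w in M. ?E (\<lambda>w. mu * om w) w = mu * ?E om w"
    by (rule real_cond_exp_cmult[OF om_integrable])
  moreover have "AE w in M. ?E (g i) w = g i w"
    by (rule real_cond_exp_F_meas[OF gi gF])
  moreover have "AE w in M. ?E om w = ombar"
    using real_cond_exp_independent[OF prob_space_axioms indep om_integrable sets_F_subset[OF i]
        subalgebra_F[OF i]] by (simp add: om_mean)
  ultimately show ?thesis
  proof eventually_elim
    case (elim w)
    define B where "B = best_response s i w"
    \<comment> \<open>First-order condition: \<open>B\<close> is where the derivative of the
      expected quadratic vanishes.\<close>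
    have B: "2 * curv * B = g i w - mu * ombar - lam * ?E ?R w"
      using curv_pos unfolding B_def best_response_def cond_exp_given_def rho_c_def
      by (simp del: distrib_left_numeral)
    have "?E ?us w - ?E ?ut w = (?x w - ?y w) * (2 * curv * B) - curv * ((?x w)\<^sup>2 - (?y w)\<^sup>2)"
      using elim unfolding diff B by simp
    also have "\<dots> = curv * ((?y w - B)\<^sup>2 - (?x w - B)\<^sup>2)"
      by (simp add: power2_eq_square algebra_simps)
    finally show ?case by (simp add: cond_exp_given_def B_def)
  qed
qed

lemma strategy_shift:
  assumes "i \<in> {1..N}" "strategy M (info i) s"
  shows "strategy M (info i) (\<lambda>x. s x - c)"
proof -
  have "integrable M (\<lambda>w. (s (info i w) - c)\<^sup>2)"
    by (rule integrable_square_diff) (use strategy_M[OF assms] strategy_square[OF assms(2)] in auto)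
  then show ?thesis using assms(2) by (auto simp: strategy_def)
qed

text \<open>Only the deviations \<open>s\<^sub>i \<plusminus> 1/n\<close> are tested, so no strategy that represents \<open>best_response\<close> is
  needed.\<close>

lemma equilibrium_iff_best_response:
  "bayesian_nash_equilibrium M N info u s \<longleftrightarrow>
    (\<forall>i\<in>{1..N}. strategy M (info i) (s i)) \<and>
    (\<forall>i\<in>{1..N}. AE w in M. s i (info i w) = best_response s i w)"
  (is "?L \<longleftrightarrow> ?S \<and> ?R")
proof (intro iffI conjI)
  assume L: ?L
  then show S: ?S by (simp add: bayesian_nash_equilibrium_def)
  show ?R
  proof
    fix i assume i: "i \<in> {1..N}"
    have dev: "AE w in M. (s i (info i w) - best_response s i w)\<^sup>2
        \<le> (s i (info i w) - c - best_response s i w)\<^sup>2" for c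
    proof -
      let ?t = "\<lambda>x. s i x - c"
      have t: "strategy M (info i) ?t" using strategy_shift[OF i] S i by blast
      have "AE w in M.
           cond_exp_given M (info i) (\<lambda>w'. u (played info s w') i w') w
         \<ge> cond_exp_given M (info i) (\<lambda>w'. u (played info (s(i := ?t)) w') i w') w"
        using L i t unfolding bayesian_nash_equilibrium_def by blast
      moreover have "AE w in M.
          cond_exp_given M (info i) (\<lambda>w'. u (played info s w') i w') w
          - cond_exp_given M (info i) (\<lambda>w'. u (played info (s(i := ?t)) w') i w') w
          = curv * ((?t (info i w) - best_response s i w)\<^sup>2 - (s i (info i w) - best_response s i w)\<^sup>2)"
        using cond_exp_payoff_diff[OF _ i t, of s] S by blast
      ultimately show ?thesis
      proof eventually_elim
        case (elim w)
        then have "0 \<le> curv * ((s i (info i w) - c - best_response s i w)\<^sup>2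
          - (s i (info i w) - best_response s i w)\<^sup>2)" by linarith
        then show ?case using curv_pos by (simp add: zero_le_mult_iff)
      qed
    qed
    \<comment> \<open>Countably many shifts share one null set, which an arbitrary real
      \<open>c\<close> would not allow directly.\<close>
    have "AE w in M. \<forall>n. (s i (info i w) - best_response s i w)\<^sup>2
        \<le> (s i (info i w) - 1 / real (Suc n) - best_response s i w)\<^sup>2"
      unfolding AE_all_countable using dev by blast
    moreover have "AE w in M. \<forall>n. (s i (info i w) - best_response s i w)\<^sup>2
        \<le> (s i (info i w) - (- 1 / real (Suc n)) - best_response s i w)\<^sup>2"
      unfolding AE_all_countable using dev by blast
    ultimately show "AE w in M. s i (info i w) = best_response s i w"
    proof eventually_elim
      case (elim w)
      define z where "z = s i (info i w) - best_response s i w"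
      \<comment> \<open>Expanding \<open>(z - e)\<^sup>2\<close> and \<open>(z + e)\<^sup>2\<close>
        leaves a term linear in \<open>z\<close> against \<open>e * e\<close>; dividing by
        \<open>e\<close> bounds \<open>z\<close> by arbitrarily small numbers.\<close>
      have "2 * \<bar>z\<bar> \<le> inverse (real (Suc n))" for n
      proof -
        define e where "e = inverse (real (Suc n))"
        have e: "e > 0" by (simp add: e_def)
        have "z\<^sup>2 \<le> (z - e)\<^sup>2" "z\<^sup>2 \<le> (z + e)\<^sup>2"
          using elim[rule_format, of n] by (simp_all add: z_def e_def algebra_simps inverse_eq_divide)
        then have "e * (2 * z) \<le> e * e" "e * (- 2 * z) \<le> e * e"
          by (simp_all add: power2_eq_square algebra_simps)
        then have "2 * z \<le> e" "- 2 * z \<le> e" using e by (simp_all only: mult_le_cancel_left_pos)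
        then show ?thesis by (simp add: e_def)
      qed
      then have "\<bar>z\<bar> \<le> 0"
        using reals_Archimedean[of "2 * \<bar>z\<bar>"] by (meson linorder_not_le mult_pos_pos zero_less_numeral)
      then show ?case by (simp add: z_def)
    qed
  qed
next
  assume SR: "?S \<and> ?R"
  then have S: ?S and R: ?R by auto
  show ?L
    unfolding bayesian_nash_equilibrium_def
  proof (intro conjI ballI allI impI)
    fix i t assume i: "i \<in> {1..N}" and t: "strategy M (info i) t"
    \<comment> \<open>At a best response the second square vanishes, so the loss from deviating is
      \<open>curv\<close> times a square.\<close>
    have "AE w in M. s i (info i w) = best_response s i w" using R i by blast
    moreover have "AE w in M.
          cond_exp_given M (info i) (\<lambda>w'. u (played info s w') i w') w
          - cond_exp_given M (info i) (\<lambda>w'. u (played info (s(i := t)) w') i w') w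
          = curv * ((t (info i w) - best_response s i w)\<^sup>2 - (s i (info i w) - best_response s i w)\<^sup>2)"
      using cond_exp_payoff_diff[OF _ i t, of s] S by blast
    ultimately show "AE w in M.
           cond_exp_given M (info i) (\<lambda>w'. u (played info s w') i w') w
         \<ge> cond_exp_given M (info i) (\<lambda>w'. u (played info (s(i := t)) w') i w') w"
    proof eventually_elim
      case (elim w)
      have "0 \<le> curv * (t (info i w) - best_response s i w)\<^sup>2" using curv_pos by simp
      with elim show ?case by simp
    qed
  qed (use S in blast)
qed

section \<open>The linear profile is an equilibrium\<close>

abbreviation "lin \<equiv> linear_strategy \<Gamma> N \<gamma> \<alpha> \<kappa> ombar"
abbreviation "ac \<equiv> a_c \<Gamma> N \<gamma> \<alpha> \<kappa>"
abbreviation "bc \<equiv> b_c \<Gamma> N \<gamma> \<alpha> \<kappa>"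

text \<open>Fixed-point equations of the best-response map on its two components: the deviation of a
  preference from the average, and the part common to all consumers.\<close>

lemma coefficients: "ac = rho * (1 + lam * ac)" "bc = rho * (1 - lam * (real N - 1) * bc)"
proof -
  have "0 \<le> lam * rho * (real N - 1)" using lam_rho N_pos by simp
  then show "ac = rho * (1 + lam * ac)" "bc = rho * (1 - lam * (real N - 1) * bc)"
    using lam_rho unfolding a_c_def b_c_def by (simp_all add: field_simps)
qed

lemma lin_eq:
  "lin (info i w) = ac * (g i w - (\<Sum>j\<in>{1..N}. g j w) / real N)
    + bc * ((\<Sum>j\<in>{1..N}. g j w) / real N - ombar * mu)"
  by (simp add: linear_strategy_def agg_info_def)

lemma strategy_lin:
  assumes i: "i \<in> {1..N}"
  shows "strategy M (info i) lin"
proof -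
  have "lin \<in> borel_measurable borel"
    unfolding linear_strategy_def case_prod_beta
    by (intro borel_measurable_continuous_onI continuous_intros)
  moreover have "integrable M (\<lambda>w. (lin (info i w))\<^sup>2)"
  proof -
    let ?G = "\<lambda>w. \<Sum>j\<in>{1..N}. g j w"
    have gM: "g j \<in> borel_measurable M" if "j \<in> {1..N}" for j
      using borel_measurable_V_imp[OF measurable_g_V[OF that]] .
    have G: "?G \<in> borel_measurable M" using gM by measurable
    have G2: "integrable M (\<lambda>w. (?G w)\<^sup>2)"
      by (rule integrable_square_sum) (use gM g_square in auto)
    \<comment> \<open>\<open>lin\<close> written as two nested differences, so that
      \<open>integrable_square_diff\<close> applies twice.\<close>
    have "integrable M (\<lambda>w. (ac * g i w - ((ac - bc) / real N * ?G w - (- bc * ombar * mu)))\<^sup>2)"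
      by (intro integrable_square_diff)
        (use gM[OF i] G G2 g_square[OF i] in \<open>simp_all add: power_mult_distrib power_divide\<close>)
    then show ?thesis
      by (rule back_subst[of "integrable M"])
        (auto simp: lin_eq fun_eq_iff intro!: arg_cong[where f = "\<lambda>x. x\<^sup>2"]
          simp: algebra_simps diff_divide_distrib add_divide_distrib)
  qed
  ultimately show ?thesis by (simp add: strategy_def)
qed

text \<open>Deviations from the average sum to zero, so those of the others add up to minus the own
  one, while the common part occurs \<open>N - 1\<close> times. The load of the others is therefore
  determined by the information of \<open>i\<close>.\<close>

lemma others_lin:
  assumes i: "i \<in> {1..N}"
  shows "others (\<lambda>_. lin) i w = - ac * (g i w - (\<Sum>j\<in>{1..N}. g j w) / real N)
    + (real N - 1) * bc * ((\<Sum>j\<in>{1..N}. g j w) / real N - ombar * mu)"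
proof -
  let ?G = "\<Sum>j\<in>{1..N}. g j w"
  have N: "real N \<noteq> 0" using N_pos by simp
  have "(\<Sum>j\<in>{1..N}. lin (info j w)) = real N * bc * (?G / real N - ombar * mu)"
    unfolding lin_eq sum.distrib sum_distrib_left[symmetric] sum_subtractf using N by (simp add: right_diff_distrib)
  moreover have "others (\<lambda>_. lin) i w = (\<Sum>j\<in>{1..N}. lin (info j w)) - lin (info i w)"
    unfolding others_def using i by (simp add: sum.remove[of _ i])
  ultimately show ?thesis by (simp add: lin_eq algebra_simps)
qed

lemma lin_best_response:
  assumes i: "i \<in> {1..N}"
  shows "AE w in M. lin (info i w) = best_response (\<lambda>_. lin) i w"
proof -
  interpret finite_measure_subalgebra M "F i"
    by unfold_locales (fact subalgebra_F[OF i])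
  let ?R = "others (\<lambda>_. lin) i"
  have st: "\<And>j. j \<in> {1..N} \<Longrightarrow> strategy M (info j) lin" by (rule strategy_lin)
  have Ri: "integrable M ?R"
    using square_integrable_imp_integrable[OF borel_measurable_V_imp[OF measurable_others_V]
        square_integrable_others, of "\<lambda>_. lin" i] st by blast
  have "?R = (\<lambda>w. (\<lambda>(x, G). - ac * (x - G / real N) + (real N - 1) * bc * (G / real N - ombar * mu)) (info i w))"
    by (simp add: others_lin[OF i] agg_info_def fun_eq_iff)
  also have "\<dots> \<in> borel_measurable (F i)"
    unfolding case_prod_beta
    by (rule measurable_info_F_compose)
      (intro borel_measurable_continuous_onI continuous_intros; use N_pos in simp)
  finally have "AE w in M. real_cond_exp M (F i) ?R w = ?R w"
    using real_cond_exp_F_meas[OF Ri] by blast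
  then show ?thesis
  proof eventually_elim
    case (elim w)
    \<comment> \<open>With \<open>p\<close> the deviation and \<open>q\<close> the common part, the
      two equations of \<open>coefficients\<close> settle the terms in \<open>p\<close> and
      \<open>q\<close> separately.\<close>
    define p where "p = g i w - (\<Sum>j\<in>{1..N}. g j w) / real N"
    define q where "q = (\<Sum>j\<in>{1..N}. g j w) / real N - ombar * mu"
    have "lin (info i w) = ac * p + bc * q" by (simp add: lin_eq p_def q_def)
    also have "\<dots> = rho * (1 + lam * ac) * p + rho * (1 - lam * (real N - 1) * bc) * q"
      using coefficients by simp
    also have "\<dots> = rho * (p + q - lam * (- ac * p + (real N - 1) * bc * q))"
      by (simp add: algebra_simps)
    also have "\<dots> = best_response (\<lambda>_. lin) i w"
      unfolding best_response_def cond_exp_given_def elim others_lin[OF i] p_def q_def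
      by (simp add: mult.commute)
    finally show ?case .
  qed
qed

section \<open>Uniqueness of the equilibrium\<close>

text \<open>A positivity argument on second moments. A contraction estimate with constant
  \<open>lam * rho * (N - 1)\<close> would not do, since that number may exceed 1.\<close>

lemma best_response_unique:
  assumes s: "\<And>i. i \<in> {1..N} \<Longrightarrow> strategy M (info i) (s i)"
      "\<And>i. i \<in> {1..N} \<Longrightarrow> AE w in M. s i (info i w) = best_response s i w"
    and t: "\<And>i. i \<in> {1..N} \<Longrightarrow> strategy M (info i) (t i)"
      "\<And>i. i \<in> {1..N} \<Longrightarrow> AE w in M. t i (info i w) = best_response t i w"
    and k: "k \<in> {1..N}"
  shows "AE w in M. s k (info k w) = t k (info k w)"
proof -
  define d where "d i w = s i (info i w) - t i (info i w)" for i w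
  define D where "D w = (\<Sum>i\<in>{1..N}. d i w)" for w
  let ?c = "lam * rho"
  have dM: "d i \<in> borel_measurable M" and d2: "integrable M (\<lambda>w. (d i w)\<^sup>2)" if "i \<in> {1..N}" for i
    unfolding d_def
    using strategy_M[OF that s(1)[OF that]] strategy_M[OF that t(1)[OF that]]
      strategy_square[OF s(1)[OF that]] strategy_square[OF t(1)[OF that]]
    by (auto intro: integrable_square_diff)
  have dd: "integrable M (\<lambda>w. d i w * d j w)" if "i \<in> {1..N}" "j \<in> {1..N}" for i j
    by (intro integrable_mult_square_integrable dM d2 that)
  have DM: "D \<in> borel_measurable M" unfolding D_def using dM by measurable
  have D2: "integrable M (\<lambda>w. (D w)\<^sup>2)" unfolding D_def by (rule integrable_square_sum[OF dM d2])
  have dD: "integrable M (\<lambda>w. d i w * D w)" if "i \<in> {1..N}" for i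
    by (intro integrable_mult_square_integrable dM d2 that DM D2)
  have key: "(1 - ?c) * expectation (\<lambda>w. (d i w)\<^sup>2) = - ?c * expectation (\<lambda>w. d i w * D w)"
    if i: "i \<in> {1..N}" for i
  proof -
    interpret finite_measure_subalgebra M "F i"
      by unfold_locales (fact subalgebra_F[OF i])
    let ?E = "real_cond_exp M (F i)"
    have RsM: "others s i \<in> borel_measurable M" by (rule borel_measurable_V_imp[OF measurable_others_V[OF s(1)]])
    have RtM: "others t i \<in> borel_measurable M" by (rule borel_measurable_V_imp[OF measurable_others_V[OF t(1)]])
    have Rs: "integrable M (others s i)"
      by (rule square_integrable_imp_integrable[OF RsM square_integrable_others[OF s(1)]])
    have Rt: "integrable M (others t i)"
      by (rule square_integrable_imp_integrable[OF RtM square_integrable_others[OF t(1)]])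
    let ?R = "\<lambda>w. others s i w - others t i w"
    \<comment> \<open>Expressing the load difference through the total \<open>D\<close>, which is
      the same for all \<open>i\<close>, is what lets the identities be summed over
      \<open>i\<close>.\<close>
    have R: "?R w = D w - d i w" for w
      unfolding D_def others_def using i by (simp add: sum.remove[of _ i] d_def sum_subtractf)
    have dF: "d i \<in> borel_measurable (F i)"
      unfolding d_def using s(1)[OF i] t(1)[OF i]
      by (auto simp: strategy_def intro!: borel_measurable_diff measurable_info_F_compose)
    have dR: "integrable M (\<lambda>w. d i w * ?R w)"
      unfolding R using dD[OF i] dd[OF i i] by (simp add: right_diff_distrib)
    have "AE w in M. (d i w)\<^sup>2 = - ?c * (d i w * ?E ?R w)"
      using s(2)[OF i] t(2)[OF i] real_cond_exp_diff[OF Rs Rt]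
    proof eventually_elim
      case (elim w)
      have "d i w = - ?c * ?E ?R w"
        unfolding d_def elim best_response_def cond_exp_given_def by (simp add: algebra_simps)
      then show ?case unfolding power2_eq_square
        by (metis mult.left_commute)
    qed
    then have "expectation (\<lambda>w. (d i w)\<^sup>2) = expectation (\<lambda>w. - ?c * (d i w * ?E ?R w))"
      by (intro integral_cong_AE) (use dM[OF i] in auto)
    \<comment> \<open>The factor \<open>d i\<close> is measurable for \<open>F i\<close>, so under
      the integral the conditional expectation may be replaced by the function itself.\<close>
    also have "\<dots> = - ?c * expectation (\<lambda>w. d i w * ?R w)"
      using real_cond_exp_intg(2)[OF dR dF] RsM RtM by simp
    also have "expectation (\<lambda>w. d i w * ?R w)
        = expectation (\<lambda>w. d i w * D w) - expectation (\<lambda>w. (d i w)\<^sup>2)"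
      unfolding R using dD[OF i] d2[OF i] by (simp add: right_diff_distrib power2_eq_square)
    finally show ?thesis by (simp add: algebra_simps)
  qed
  have "(1 - ?c) * (\<Sum>i\<in>{1..N}. expectation (\<lambda>w. (d i w)\<^sup>2))
      = - ?c * (\<Sum>i\<in>{1..N}. expectation (\<lambda>w. d i w * D w))"
    unfolding sum_distrib_left by (rule sum.cong[OF refl key])
  also have "(\<Sum>i\<in>{1..N}. expectation (\<lambda>w. d i w * D w)) = expectation (\<lambda>w. (D w)\<^sup>2)"
  proof -
    have "(\<Sum>i\<in>{1..N}. expectation (\<lambda>w. d i w * D w)) = expectation (\<lambda>w. \<Sum>i\<in>{1..N}. d i w * D w)"
      by (rule Bochner_Integration.integral_sum[symmetric]) (rule dD)
    then show ?thesis
      unfolding sum_distrib_right[symmetric] D_def[symmetric] power2_eq_square .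
  qed
  finally have "(1 - ?c) * (\<Sum>i\<in>{1..N}. expectation (\<lambda>w. (d i w)\<^sup>2)) = - ?c * expectation (\<lambda>w. (D w)\<^sup>2)" .
  \<comment> \<open>The left side of the identity is a positive multiple of a sum of second moments
    and the right side is at most 0, so each second moment vanishes.\<close>
  moreover have "0 \<le> ?c * expectation (\<lambda>w. (D w)\<^sup>2)" using lam_rho(1) by simp
  ultimately have "(1 - ?c) * (\<Sum>i\<in>{1..N}. expectation (\<lambda>w. (d i w)\<^sup>2)) \<le> 0" by simp
  then have "(\<Sum>i\<in>{1..N}. expectation (\<lambda>w. (d i w)\<^sup>2)) \<le> 0"
    using lam_rho(2) by (simp add: mult_le_0_iff)
  moreover have "expectation (\<lambda>w. (d k w)\<^sup>2) \<le> (\<Sum>i\<in>{1..N}. expectation (\<lambda>w. (d i w)\<^sup>2))"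
    using k by (intro member_le_sum) auto
  moreover have "0 \<le> expectation (\<lambda>w. (d k w)\<^sup>2)" by simp
  ultimately have "expectation (\<lambda>w. (d k w)\<^sup>2) = 0" by linarith
  then show ?thesis
    using integral_nonneg_eq_0_iff_AE[OF d2[OF k]] by (simp add: d_def)
qed

lemma unique_equilibrium:
  "bayesian_nash_equilibrium M N info u (\<lambda>_. lin)"
  "bayesian_nash_equilibrium M N info u s \<Longrightarrow> i \<in> {1..N} \<Longrightarrow> AE w in M. s i (info i w) = lin (info i w)"
  using strategy_lin lin_best_response best_response_unique[of s "\<lambda>_. lin" i]
  unfolding equilibrium_iff_best_response by blast+

end

section \<open>From the preference law to the one-slot game\<close>

lemma normal_correlated_preferences_square_integrable:
  assumes M: "prob_space M" and g: "normal_correlated_preferences M N gbar \<sigma> g"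
    and i: "i \<in> {1..N}" and [measurable]: "g i \<in> borel_measurable M"
  shows "integrable M (\<lambda>w. (g i w)\<^sup>2)"
proof -
  interpret prob_space M by (fact M)
  have "expectation (\<lambda>w. (g i w - gbar) * (g i w - gbar)) = 1"
    using g i unfolding normal_correlated_preferences_def by auto
  \<comment> \<open>The Bochner integral of a non-integrable function is 0 by convention, so the
    value 1 of the variance forces integrability.\<close>
  then have "integrable M (\<lambda>w. (g i w - gbar)\<^sup>2)"
    unfolding power2_eq_square using not_integrable_integral_eq by fastforce
  then have "integrable M (\<lambda>w. ((g i w - gbar) - (- gbar))\<^sup>2)"
    by (rule integrable_square_diff[rotated 2]) auto
  then show ?thesis by simp
qed

theorem proposition3:
  fixes M :: "'w measure" and N :: nat and H :: "'h set"
    and \<gamma> \<alpha> \<kappa> \<sigma> gbar ombar :: "'h \<Rightarrow> real"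
    and g :: "'h \<Rightarrow> nat \<Rightarrow> 'w \<Rightarrow> real" and om :: "'h \<Rightarrow> 'w \<Rightarrow> real"
    and \<Gamma> :: behavior
  assumes "prob_space M" and "N \<ge> 1"
    and "\<And>h. h \<in> H \<Longrightarrow> \<gamma> h > 0 \<and> \<alpha> h > 0 \<and> \<kappa> h > 0"
    and "\<And>h. h \<in> H \<Longrightarrow> integrable M (om h) \<and> integral\<^sup>L M (om h) = ombar h"
    and "\<And>h. h \<in> H \<Longrightarrow>
           independent_rvs M borel (om h)
             (Pi\<^sub>M {1..N} (\<lambda>_. borel)) (\<lambda>w. \<lambda>i\<in>{1..N}. g h i w)"
    and "\<And>h. h \<in> H \<Longrightarrow> gbar h > 0"
    and "\<And>h. h \<in> H \<Longrightarrow> 0 \<le> \<sigma> h \<and> \<sigma> h \<le> 1"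
    and "\<And>h. h \<in> H \<Longrightarrow> normal_correlated_preferences M N (gbar h) (\<sigma> h) (g h)"
  shows "\<forall>h\<in>H.
    (let info = agg_info N (g h);
         u = (\<lambda>l i w. payoff \<Gamma> N (\<gamma> h) (\<alpha> h) (\<kappa> h) (\<lambda>j. g h j w) (om h w) l i);
         s_lin = linear_strategy \<Gamma> N (\<gamma> h) (\<alpha> h) (\<kappa> h) (ombar h)
     in bayesian_nash_equilibrium M N info u (\<lambda>i. s_lin) \<and>
        (\<forall>s. bayesian_nash_equilibrium M N info u s \<longrightarrow>
           (\<forall>i\<in>{1..N}. AE w in M. s i (info i w) = s_lin (info i w))))"
proof
  fix h assume h: "h \<in> H"
  interpret prob_space M by fact
  have vec: "(\<lambda>w. \<lambda>i\<in>{1..N}. g h i w) \<in> measurable M (Pi\<^sub>M {1..N} (\<lambda>_. borel))"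
    using assms(5)[OF h] by (simp add: independent_rvs_def)
  have gM: "g h i \<in> borel_measurable M" if "i \<in> {1..N}" for i
    using measurable_compose[OF vec measurable_component_singleton[OF that]] that by simp
  \<comment> \<open>The slots do not interact, so each is an instance of the one-slot game.\<close>
  interpret consumption_game M \<Gamma> N "\<gamma> h" "\<alpha> h" "\<kappa> h" "ombar h" "g h" "om h"
    using assms(2) assms(3-5)[OF h]
      normal_correlated_preferences_square_integrable[OF assms(1) assms(8)[OF h] _ gM]
    by unfold_locales auto
  show "let info = agg_info N (g h);
         u = (\<lambda>l i w. payoff \<Gamma> N (\<gamma> h) (\<alpha> h) (\<kappa> h) (\<lambda>j. g h j w) (om h w) l i);
         s_lin = linear_strategy \<Gamma> N (\<gamma> h) (\<alpha> h) (\<kappa> h) (ombar h)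
     in bayesian_nash_equilibrium M N info u (\<lambda>i. s_lin) \<and>
        (\<forall>s. bayesian_nash_equilibrium M N info u s \<longrightarrow>
           (\<forall>i\<in>{1..N}. AE w in M. s i (info i w) = s_lin (info i w)))"
    unfolding Let_def using unique_equilibrium by blast
qed

end
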